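(* For every $N \in \mathbb{N}$, there exist constants $c_1 = c_1(N) > 0$ and $c_2 = c_2(N) > 0$ such that for all $1 \leq p < \infty$ and all $u \in L^p(\mathbb{R}^N)$, $$c_1^{1/p} \|u\|_{L^p(\mathbb{R}^N)} \leq \left[\frac{u(x)-u(y)}{|x-y|^{\frac{N}{p}}}\right]_{L^{p,\infty}(\mathbb{R}^N \times \mathbb{R}^N)} \leq 2 c_2^{1/p} \|u\|_{L^p(\mathbb{R}^N)}.$$ Moreover, for $1 \leq p < \infty$ and $u \in L^p(\mathbb{R}^N)$, if for $\lambda>0$ we write $$E_{\lambda} := \left\{ (x,y) \in \mathbb{R}^N \times \mathbb{R}^N : x \neq y, \ \frac{|u(x)-u(y)|}{|x-y|^{\frac{N}{p}}} \geq \lambda \right\},$$ then $$\lim_{\lambda \rightarrow 0^+}\lambda^p \mathcal{L}^{2N}(E_{\lambda}) = 2\kappa_N\|u\|^p_{L^p(\mathbb{R}^N)},$$ where $\kappa_N := \pi^{N/2}/\Gamma(\frac{N}{2}+1)$ is the volume of the unit ball in $\mathbb{R}^N$.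
   Context: $\mathcal{L}^{2N}$ denotes Lebesgue measure on $\mathbb{R}^{2N} = \mathbb{R}^N\times\mathbb{R}^N$, and $|\cdot|$ is the Euclidean norm. For a measurable function $F(x,y)$ on $\mathbb{R}^N \times \mathbb{R}^N$ (defined almost everywhere) and $1 \leq p < \infty$, the weak-$L^p$ quasi-norm is $$[F]_{L^{p,\infty}(\mathbb{R}^N \times \mathbb{R}^N)} := \sup_{\lambda > 0} \left( \lambda^p \mathcal{L}^{2N} \{(x,y) \in \mathbb{R}^{2N} : |F(x,y)| \geq \lambda\}\right)^{1/p}.$$ The function $\frac{u(x)-u(y)}{|x-y|^{N/p}}$ is considered off the null set $\{x=y\}$. *)

theory Defs
  imports "HOL-Analysis.Analysis"
begin

definition Lp_space :: "real \<Rightarrow> (real ^ 'n \<Rightarrow> real) set" where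
  "Lp_space p =
     {u. u \<in> borel_measurable lebesgue \<and> integrable lebesgue (\<lambda>x. \<bar>u x\<bar> powr p)}"

definition Lp_norm :: "real \<Rightarrow> (real ^ 'n \<Rightarrow> real) \<Rightarrow> real" where
  "Lp_norm p u = (LINT x|lebesgue. \<bar>u x\<bar> powr p) powr (1 / p)"

text \<open>Only used for exponents \<open>r > 0\<close>, where \<open>\<infinity>\<close> to the power \<open>r\<close> is \<open>\<infinity>\<close>.\<close>

definition ennreal_powr :: "ennreal \<Rightarrow> real \<Rightarrow> ennreal" where
  "ennreal_powr a r = (if a = top then top else ennreal (enn2real a powr r))"

text \<open>The value lies in \<open>ennreal\<close>, so that the supremum is not cut off when it is infinite.\<close>

definition weak_Lp_norm :: "real \<Rightarrow> ((real ^ 'n) \<times> (real ^ 'n) \<Rightarrow> real) \<Rightarrow> ennreal" where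
  "weak_Lp_norm p F =
     (SUP l\<in>{0<..}.
        ennreal_powr (ennreal (l powr p) * emeasure lebesgue {z. \<bar>F z\<bar> \<ge> l}) (1 / p))"

text \<open>On the diagonal this total function takes the value \<open>0 / 0 = 0\<close>, so
  diagonal points belong to no set \<open>{z. \<bar>F z\<bar> \<ge> l}\<close> with \<open>l > 0\<close>.\<close>

definition diff_quotient :: "real \<Rightarrow> (real ^ 'n \<Rightarrow> real) \<Rightarrow> (real ^ 'n) \<times> (real ^ 'n) \<Rightarrow> real" where
  "diff_quotient p u = (\<lambda>(x, y). (u x - u y) / norm (x - y) powr (real CARD('n) / p))"

definition superlevel_set ::
  "real \<Rightarrow> (real ^ 'n \<Rightarrow> real) \<Rightarrow> real \<Rightarrow> ((real ^ 'n) \<times> (real ^ 'n)) set" where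
  "superlevel_set p u l =
     {(x, y). x \<noteq> y \<and> \<bar>u x - u y\<bar> / norm (x - y) powr (real CARD('n) / p) \<ge> l}"

end

theory Submission
  imports Defs
begin

text \<open>
  If a pair \<open>(x, y)\<close> of \<open>quotient_set\<close> satisfies \<open>\<bar>u y\<bar> \<le> \<bar>u x\<bar>\<close>, then
  \<open>l * \<bar>x - y\<bar> powr (N / p) \<le> 2 * \<bar>u x\<bar>\<close>, so for fixed \<open>x\<close> such \<open>y\<close> lie in a ball of
  measure \<open>\<kappa> * (2 * \<bar>u x\<bar> / l) powr p\<close>. Splitting the pairs according to which of \<open>\<bar>u x\<bar>\<close>,
  \<open>\<bar>u y\<bar>\<close> is larger and using Fubini, this yields the upper bound with \<open>c2 = 2 * \<kappa>\<close>. As \<open>l\<close>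
  tends to \<open>0\<close> the balls grow, while \<open>\<bar>u y\<bar> < \<epsilon>\<close> off a set of finite measure; hence the rescaled
  measure of the slice at \<open>x\<close> tends to \<open>\<kappa> * \<bar>u x\<bar> powr p\<close>, and dominated convergence gives the
  limit, each half contributing \<open>\<kappa>\<close> times the integral of \<open>\<bar>u\<bar> powr p\<close>. The lower bound with
  \<open>c1 = 2 * \<kappa>\<close> holds because the supremum dominates the limit.
\<close>

section \<open>Measures of balls and of superlevel sets\<close>

text \<open>The exponents \<open>DIM('a) / p\<close> and \<open>p / DIM('a)\<close> are inverse, so
  the set is a closed ball whose radius to the power \<open>DIM('a)\<close> is
  \<open>(b / l) powr p\<close>. Multiplied by \<open>l powr p\<close>, its measure no longer
  depends on \<open>l\<close>; this scaling underlies all later estimates.\<close>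

lemma emeasure_powr_ball:
  fixes x :: "'a::euclidean_space"
  assumes "l > 0" "b \<ge> 0" "p > 0"
  shows "emeasure lborel {y. l * norm (x - y) powr (DIM('a) / p) \<le> b}
    = ennreal (unit_ball_vol (DIM('a)) * b powr p / l powr p)"
proof -
  define D where "D = real DIM('a)"
  have D: "D > 0" by (simp add: D_def)
  have "l * norm (x - y) powr (D / p) \<le> b \<longleftrightarrow> norm (x - y) \<le> (b / l) powr (p / D)" for y
  proof
    assume "l * norm (x - y) powr (D / p) \<le> b"
    then have "norm (x - y) powr (D / p) \<le> b / l"
      using assms by (simp add: field_simps)
    then have "(norm (x - y) powr (D / p)) powr (p / D) \<le> (b / l) powr (p / D)"
      using assms D by (intro powr_mono2) auto
    then show "norm (x - y) \<le> (b / l) powr (p / D)"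
      using assms D by (simp add: powr_powr)
  next
    assume "norm (x - y) \<le> (b / l) powr (p / D)"
    then have "norm (x - y) powr (D / p) \<le> ((b / l) powr (p / D)) powr (D / p)"
      using assms D by (intro powr_mono2) auto
    also have "\<dots> = b / l"
      using assms D by (simp add: powr_powr)
    finally show "l * norm (x - y) powr (D / p) \<le> b"
      using assms by (simp add: field_simps)
  qed
  then have "{y. l * norm (x - y) powr (D / p) \<le> b} = cball x ((b / l) powr (p / D))"
    by (simp only: cball_def dist_norm)
  moreover have "((b / l) powr (p / D)) ^ DIM('a) = (b / l) powr p"
    by (cases "b / l = 0") (auto simp: powr_power D_def)
  then have "((b / l) powr (p / D)) ^ DIM('a) = b powr p / l powr p"
    using assms by (simp add: powr_divide)
  ultimately show ?thesis
    using assms by (simp add: emeasure_cball D_def)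
qed

text \<open>Markov's inequality for \<open>\<bar>v x\<bar> powr p\<close> at height
  \<open>\<epsilon> powr p\<close>. It provides the exceptional set of finite measure in the limit
  of the slices.\<close>

lemma emeasure_superlevel_finite:
  fixes v :: "'a \<Rightarrow> real"
  assumes [measurable]: "v \<in> borel_measurable M"
    and fin: "(\<integral>\<^sup>+x. ennreal (\<bar>v x\<bar> powr p) \<partial>M) < \<infinity>"
    and "\<epsilon> > 0" "p \<ge> 0"
  shows "emeasure M {x \<in> space M. \<epsilon> \<le> \<bar>v x\<bar>} < \<infinity>"
proof -
  have "emeasure M {x \<in> space M. \<epsilon> \<le> \<bar>v x\<bar>}
      \<le> emeasure M {x \<in> space M. 1 \<le> ennreal (1 / \<epsilon> powr p) * ennreal (\<bar>v x\<bar> powr p)}"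
  proof (rule emeasure_mono)
    show "{x \<in> space M. \<epsilon> \<le> \<bar>v x\<bar>}
        \<subseteq> {x \<in> space M. 1 \<le> ennreal (1 / \<epsilon> powr p) * ennreal (\<bar>v x\<bar> powr p)}"
      using assms powr_mono2[of p \<epsilon>]
      by (auto simp flip: ennreal_mult simp: field_simps)
  qed measurable
  also have "\<dots> \<le> ennreal (1 / \<epsilon> powr p)
      * (\<integral>\<^sup>+x. ennreal (\<bar>v x\<bar> powr p) * indicator (space M) x \<partial>M)"
    by (rule nn_integral_Markov_inequality) measurable
  also have "(\<integral>\<^sup>+x. ennreal (\<bar>v x\<bar> powr p) * indicator (space M) x \<partial>M)
      = (\<integral>\<^sup>+x. ennreal (\<bar>v x\<bar> powr p) \<partial>M)"
    by (intro nn_integral_cong) simp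
  finally show ?thesis
    using fin by (auto simp: ennreal_mult_less_top intro: order.strict_trans1)
qed

section \<open>Half slices: measurability, uniform bound and limit\<close>

text \<open>The relation \<open>R\<close> is \<open>\<le>\<close> for one half of the pairs and \<open><\<close> for the other, so that
  pairs with \<open>\<bar>v x\<bar> = \<bar>v y\<bar>\<close> are counted once.\<close>

definition half_slice ::
  "(real \<Rightarrow> real \<Rightarrow> bool) \<Rightarrow> real \<Rightarrow> ('a::euclidean_space \<Rightarrow> real) \<Rightarrow> real \<Rightarrow> 'a \<Rightarrow> 'a set" where
  "half_slice R p v l x = {y. R \<bar>v y\<bar> \<bar>v x\<bar> \<and> x \<noteq> y \<and>
     l * norm (x - y) powr (DIM('a) / p) \<le> \<bar>v x - v y\<bar>}"

text \<open>Both orientations are recorded because one half of the pairs is sliced at a fixed first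
  coordinate and the other at a fixed second one.\<close>

lemma half_slice_pred_measurable:
  fixes v :: "'a::euclidean_space \<Rightarrow> real"
  assumes [measurable]: "v \<in> borel_measurable borel" and R: "R = (\<le>) \<or> R = (<)"
  shows "{(x, y). y \<in> half_slice R p v l x} \<in> sets (lborel \<Otimes>\<^sub>M lborel)"
    and "{(x, y). x \<in> half_slice R p v l y} \<in> sets (lborel \<Otimes>\<^sub>M lborel)"
proof -
  have "Measurable.pred (borel \<Otimes>\<^sub>M borel) (\<lambda>z. snd z \<in> half_slice R p v l (fst z))"
    using R unfolding half_slice_def by (elim disjE) (simp_all, measurable)
  then show "{(x, y). y \<in> half_slice R p v l x} \<in> sets (lborel \<Otimes>\<^sub>M lborel)"
    by (simp add: pred_def case_prod_beta' space_pair_measure cong: sets_pair_measure_cong)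
  have "Measurable.pred (borel \<Otimes>\<^sub>M borel) (\<lambda>z. fst z \<in> half_slice R p v l (snd z))"
    using R unfolding half_slice_def by (elim disjE) (simp_all, measurable)
  then show "{(x, y). x \<in> half_slice R p v l y} \<in> sets (lborel \<Otimes>\<^sub>M lborel)"
    by (simp add: pred_def case_prod_beta' space_pair_measure cong: sets_pair_measure_cong)
qed

lemma half_slice_measurable:
  fixes v :: "'a::euclidean_space \<Rightarrow> real"
  assumes "v \<in> borel_measurable borel" and "R = (\<le>) \<or> R = (<)"
  shows "half_slice R p v l x \<in> sets borel"
    and "(\<lambda>x. emeasure lborel (half_slice R p v l x)) \<in> borel_measurable borel"
proof -
  have eq: "Pair x -` {(x, y). y \<in> half_slice R p v l x} = half_slice R p v l x" for x
    by auto
  show "half_slice R p v l x \<in> sets borel"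
    using sets_Pair1[OF half_slice_pred_measurable(1)[OF assms, of p l], of x] unfolding eq by simp
  show "(\<lambda>x. emeasure lborel (half_slice R p v l x)) \<in> borel_measurable borel"
    using sigma_finite_measure.measurable_emeasure_Pair[OF sigma_finite_lborel half_slice_pred_measurable(1)[OF assms, of p l]]
    unfolding eq by simp
qed

text \<open>Either choice of \<open>R\<close> gives
  \<open>\<bar>v y\<bar> \<le> \<bar>v x\<bar>\<close>, so the triangle inequality puts the slice
  into the ball for \<open>2 * \<bar>v x\<bar>\<close>. The bound is free of \<open>l\<close>, so it
  yields the uniform estimate and also serves as dominating function.\<close>

lemma emeasure_half_slice_le:
  fixes v :: "'a::euclidean_space \<Rightarrow> real"
  assumes [measurable]: "v \<in> borel_measurable borel"
    and R: "R = (\<le>) \<or> R = (<)" and "l > 0" "p > 0"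
  shows "ennreal (l powr p) * emeasure lborel (half_slice R p v l x)
    \<le> ennreal (unit_ball_vol (DIM('a)) * (2 * \<bar>v x\<bar>) powr p)"
proof -
  have "half_slice R p v l x \<subseteq> {y. l * norm (x - y) powr (DIM('a) / p) \<le> 2 * \<bar>v x\<bar>}"
    using R by (auto simp: half_slice_def)
  then have "emeasure lborel (half_slice R p v l x)
      \<le> emeasure lborel {y. l * norm (x - y) powr (DIM('a) / p) \<le> 2 * \<bar>v x\<bar>}"
    by (rule emeasure_mono) measurable
  also have "\<dots> = ennreal (unit_ball_vol (DIM('a)) * (2 * \<bar>v x\<bar>) powr p / l powr p)"
    using assms by (intro emeasure_powr_ball) auto
  finally have "ennreal (l powr p) * emeasure lborel (half_slice R p v l x)
      \<le> ennreal (l powr p) * ennreal (unit_ball_vol (DIM('a)) * (2 * \<bar>v x\<bar>) powr p / l powr p)"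
    by (rule mult_left_mono) simp
  then show ?thesis
    using assms by (simp flip: ennreal_mult)
qed

text \<open>Outside the set where \<open>\<bar>v\<bar> \<ge> \<epsilon>\<close>, whose finite measure is killed by the factor
  \<open>l powr p\<close>, the slice is squeezed between the balls for \<open>\<bar>v x\<bar> - \<epsilon>\<close> and \<open>\<bar>v x\<bar> + \<epsilon>\<close>.\<close>

lemma half_slice_tendsto:
  fixes v :: "'a::euclidean_space \<Rightarrow> real"
  assumes [measurable]: "v \<in> borel_measurable borel"
    and R: "R = (\<le>) \<or> R = (<)" and p: "p > 0"
    and fin: "(\<integral>\<^sup>+x. ennreal (\<bar>v x\<bar> powr p) \<partial>lborel) < \<infinity>"
  shows "((\<lambda>l. ennreal (l powr p) * emeasure lborel (half_slice R p v l x))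
    \<longlongrightarrow> ennreal (unit_ball_vol (DIM('a)) * \<bar>v x\<bar> powr p)) (at_right 0)"
proof (cases "v x = 0")
  case True
  have "ennreal (l powr p) * emeasure lborel (half_slice R p v l x) = 0" if "l > 0" for l
    using emeasure_half_slice_le[OF assms(1) R that p, of x] True by simp
  then have "\<forall>\<^sub>F l in at_right 0. 0 = ennreal (l powr p) * emeasure lborel (half_slice R p v l x)"
    by (auto simp: eventually_at_right_less eventually_at_filter)
  with True show ?thesis
    by (auto intro: Lim_transform_eventually[OF tendsto_const])
next
  case False
  define a where "a = \<bar>v x\<bar>"
  define \<kappa> where "\<kappa> = unit_ball_vol (DIM('a))"
  define ball where "ball l b = {y. l * norm (x - y) powr (DIM('a) / p) \<le> b}" for l b
  define S where "S \<epsilon> = {y. \<epsilon> \<le> \<bar>v y\<bar>}" for \<epsilon>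
  \<comment> \<open>The squeeze is done in the reals because the lower estimate subtracts;
    \<open>hs_fin\<close> permits the return to \<open>emeasure\<close>.\<close>
  define g where "g l = l powr p * measure lborel (half_slice R p v l x)" for l
  have a: "a > 0" using False by (simp add: a_def)
  have [measurable]: "half_slice R p v l x \<in> sets borel" "ball l b \<in> sets borel"
    "S \<epsilon> \<in> sets borel" for l b \<epsilon>
    unfolding ball_def S_def using half_slice_measurable(1)[OF assms(1) R] by auto
  have S_fin: "emeasure lborel (S \<epsilon>) < \<infinity>" if "\<epsilon> > 0" for \<epsilon>
    using emeasure_superlevel_finite[of v lborel p \<epsilon>] fin that p by (simp add: S_def)
  have ball_e: "emeasure lborel (ball l b) = ennreal (\<kappa> * b powr p / l powr p)"
    if "l > 0" "b \<ge> 0" for l b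
    using emeasure_powr_ball[OF that p] by (simp add: ball_def \<kappa>_def)
  have ball_m: "l powr p * measure lborel (ball l b) = \<kappa> * b powr p" if "l > 0" "b \<ge> 0" for l b
    using ball_e[OF that] that by (simp add: measure_def \<kappa>_def)
  have hs_fin: "emeasure lborel (half_slice R p v l x) < \<infinity>" if "l > 0" for l
  proof -
    have "half_slice R p v l x \<subseteq> ball l (2 * a)"
      using R by (auto simp: half_slice_def ball_def a_def)
    then have "emeasure lborel (half_slice R p v l x) \<le> emeasure lborel (ball l (2 * a))"
      by (intro emeasure_mono) auto
    also have "\<dots> < \<infinity>" using ball_e[of l "2 * a"] a that by simp
    finally show ?thesis .
  qed
  have upper: "g l \<le> \<kappa> * (a + \<epsilon>) powr p + l powr p * measure lborel (S \<epsilon>)"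
    if "l > 0" "\<epsilon> > 0" for l \<epsilon>
  proof -
    \<comment> \<open>Off \<open>S \<epsilon>\<close> the difference
      \<open>\<bar>v x - v y\<bar>\<close> is at most \<open>a + \<epsilon>\<close>.\<close>
    have "half_slice R p v l x \<subseteq> ball l (a + \<epsilon>) \<union> S \<epsilon>"
      by (auto simp: half_slice_def ball_def S_def a_def)
    moreover have "ball l (a + \<epsilon>) \<in> fmeasurable lborel" "S \<epsilon> \<in> fmeasurable lborel"
      using ball_e[of l "a + \<epsilon>"] S_fin that a by (auto intro: fmeasurableI)
    ultimately have "measure lborel (half_slice R p v l x)
        \<le> measure lborel (ball l (a + \<epsilon>)) + measure lborel (S \<epsilon>)"
      by (intro order.trans[OF measure_mono_fmeasurable measure_Un_le]) auto
    then have "g l \<le> l powr p * (measure lborel (ball l (a + \<epsilon>)) + measure lborel (S \<epsilon>))"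
      unfolding g_def by (intro mult_left_mono) auto
    then show ?thesis
      using ball_m[of l "a + \<epsilon>"] that a by (simp add: algebra_simps)
  qed
  have lower: "\<kappa> * (a - \<epsilon>) powr p - l powr p * measure lborel (S \<epsilon>) \<le> g l"
    if "l > 0" "\<epsilon> > 0" "\<epsilon> < a" for l \<epsilon>
  proof -
    \<comment> \<open>Off \<open>S \<epsilon>\<close>,
      \<open>\<bar>v y\<bar> < \<epsilon> < a\<close> gives the relation \<open>R\<close> in both
      its forms and \<open>\<bar>v x - v y\<bar> \<ge> a - \<epsilon>\<close>. The null set
      \<open>{x}\<close> covers the centre, which the slice leaves out.\<close>
    have "ball l (a - \<epsilon>) \<subseteq> (half_slice R p v l x \<union> S \<epsilon>) \<union> {x}"
      using R that by (auto simp: half_slice_def ball_def S_def a_def)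
    moreover have fm: "half_slice R p v l x \<in> fmeasurable lborel" "S \<epsilon> \<in> fmeasurable lborel"
        "{x} \<in> fmeasurable lborel"
      using hs_fin S_fin that by (auto intro!: fmeasurableI)
    ultimately have "measure lborel (ball l (a - \<epsilon>))
        \<le> measure lborel ((half_slice R p v l x \<union> S \<epsilon>) \<union> {x})"
      by (intro measure_mono_fmeasurable fmeasurable.Un) auto
    also have "\<dots> \<le> measure lborel (half_slice R p v l x \<union> S \<epsilon>) + measure lborel {x}"
      by (intro measure_Un_le) auto
    also have "\<dots> \<le> measure lborel (half_slice R p v l x) + measure lborel (S \<epsilon>)"
      using measure_Un_le[of "half_slice R p v l x" lborel "S \<epsilon>"] by (simp add: measure_def)
    finally have "l powr p * measure lborel (ball l (a - \<epsilon>))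
        \<le> l powr p * (measure lborel (half_slice R p v l x) + measure lborel (S \<epsilon>))"
      by (intro mult_left_mono) auto
    then show ?thesis
      using ball_m[of l "a - \<epsilon>"] that by (simp add: algebra_simps g_def)
  qed
  have l0: "((\<lambda>l. l powr p) \<longlongrightarrow> 0) (at_right 0)"
    using p by (auto intro!: tendsto_eq_intros tendsto_zero_powrI[where b = p] simp: eventually_at_filter)
  have pos: "\<forall>\<^sub>F l in at_right 0. (0::real) < l"
    by (rule eventually_at_right_less)
  have "(g \<longlongrightarrow> \<kappa> * a powr p) (at_right 0)"
  proof (rule order_tendstoI)
    fix c assume c: "c < \<kappa> * a powr p"
    \<comment> \<open>The order of the limits matters: \<open>\<epsilon>\<close> is first fixed by
      continuity so that the main term still exceeds \<open>c\<close>, and only then does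
      \<open>l\<close> tend to \<open>0\<close>, which removes the term with
      \<open>S \<epsilon>\<close>.\<close>
    have "((\<lambda>\<epsilon>. \<kappa> * (a - \<epsilon>) powr p) \<longlongrightarrow> \<kappa> * (a - 0) powr p) (at_right 0)"
      using a by (intro tendsto_intros) auto
    then have "\<forall>\<^sub>F \<epsilon> in at_right 0. c < \<kappa> * (a - \<epsilon>) powr p"
      using c by (auto dest: order_tendstoD)
    then have "\<forall>\<^sub>F \<epsilon> in at_right 0. c < \<kappa> * (a - \<epsilon>) powr p \<and> 0 < \<epsilon> \<and> \<epsilon> < a"
      using pos eventually_at_right_field[of "\<lambda>\<epsilon>. \<epsilon> < a" 0] a
      by (auto intro: eventually_conj)
    then obtain \<epsilon> where \<epsilon>: "c < \<kappa> * (a - \<epsilon>) powr p" "0 < \<epsilon>" "\<epsilon> < a"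
      using eventually_happens'[OF trivial_limit_at_right_real] by blast
    have "((\<lambda>l. \<kappa> * (a - \<epsilon>) powr p - l powr p * measure lborel (S \<epsilon>))
        \<longlongrightarrow> \<kappa> * (a - \<epsilon>) powr p - 0 * measure lborel (S \<epsilon>)) (at_right 0)"
      by (intro tendsto_intros l0)
    then have "\<forall>\<^sub>F l in at_right 0. c < \<kappa> * (a - \<epsilon>) powr p - l powr p * measure lborel (S \<epsilon>)"
      using \<epsilon> by (auto dest: order_tendstoD)
    with pos show "\<forall>\<^sub>F l in at_right 0. c < g l"
      by eventually_elim (use lower \<epsilon> in fastforce)
  next
    fix c assume c: "\<kappa> * a powr p < c"
    have "((\<lambda>\<epsilon>. \<kappa> * (a + \<epsilon>) powr p) \<longlongrightarrow> \<kappa> * (a + 0) powr p) (at_right 0)"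
      using a by (intro tendsto_intros) auto
    then have "\<forall>\<^sub>F \<epsilon> in at_right 0. \<kappa> * (a + \<epsilon>) powr p < c"
      using c by (auto dest: order_tendstoD)
    then have "\<forall>\<^sub>F \<epsilon> in at_right 0. \<kappa> * (a + \<epsilon>) powr p < c \<and> 0 < \<epsilon>"
      using pos by (auto intro: eventually_conj)
    then obtain \<epsilon> where \<epsilon>: "\<kappa> * (a + \<epsilon>) powr p < c" "0 < \<epsilon>"
      using eventually_happens'[OF trivial_limit_at_right_real] by blast
    have "((\<lambda>l. \<kappa> * (a + \<epsilon>) powr p + l powr p * measure lborel (S \<epsilon>))
        \<longlongrightarrow> \<kappa> * (a + \<epsilon>) powr p + 0 * measure lborel (S \<epsilon>)) (at_right 0)"
      by (intro tendsto_intros l0)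
    then have "\<forall>\<^sub>F l in at_right 0. \<kappa> * (a + \<epsilon>) powr p + l powr p * measure lborel (S \<epsilon>) < c"
      using \<epsilon> by (auto dest: order_tendstoD)
    with pos show "\<forall>\<^sub>F l in at_right 0. g l < c"
      by eventually_elim (use upper \<epsilon> in fastforce)
  qed
  then have "((\<lambda>l. ennreal (g l)) \<longlongrightarrow> ennreal (\<kappa> * a powr p)) (at_right 0)"
    by (rule tendsto_ennrealI)
  moreover have "\<forall>\<^sub>F l in at_right 0.
      ennreal (g l) = ennreal (l powr p) * emeasure lborel (half_slice R p v l x)"
    using pos
    by eventually_elim (use hs_fin in \<open>simp add: g_def ennreal_mult emeasure_eq_ennreal_measure less_top\<close>)
  ultimately show ?thesis
    unfolding a_def \<kappa>_def by (rule Lim_transform_eventually)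
qed

section \<open>Integrals of the slice measures\<close>

lemma nn_integral_half_slice_le:
  fixes v :: "'a::euclidean_space \<Rightarrow> real"
  assumes [measurable]: "v \<in> borel_measurable borel"
    and R: "R = (\<le>) \<or> R = (<)" and l: "l > 0" and p: "p > 0"
  shows "(\<integral>\<^sup>+x. ennreal (l powr p) * emeasure lborel (half_slice R p v l x) \<partial>lborel)
    \<le> ennreal (unit_ball_vol (DIM('a)) * 2 powr p) * (\<integral>\<^sup>+x. ennreal (\<bar>v x\<bar> powr p) \<partial>lborel)"
proof -
  have "(\<integral>\<^sup>+x. ennreal (l powr p) * emeasure lborel (half_slice R p v l x) \<partial>lborel)
      \<le> (\<integral>\<^sup>+x. ennreal (unit_ball_vol (DIM('a)) * 2 powr p) * ennreal (\<bar>v x\<bar> powr p) \<partial>lborel)"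
    using emeasure_half_slice_le[OF assms]
    by (intro nn_integral_mono) (simp add: powr_mult mult.assoc flip: ennreal_mult)
  then show ?thesis
    by (simp add: nn_integral_cmult)
qed

text \<open>Dominated convergence is a statement about sequences, so the one-sided limit is tested
  along an arbitrary positive sequence \<open>X\<close> tending to \<open>0\<close>.\<close>

lemma nn_integral_half_slice_tendsto:
  fixes v :: "'a::euclidean_space \<Rightarrow> real"
  assumes [measurable]: "v \<in> borel_measurable borel"
    and R: "R = (\<le>) \<or> R = (<)" and p: "p > 0"
    and fin: "(\<integral>\<^sup>+x. ennreal (\<bar>v x\<bar> powr p) \<partial>lborel) < \<infinity>"
  shows "((\<lambda>l. \<integral>\<^sup>+x. ennreal (l powr p) * emeasure lborel (half_slice R p v l x) \<partial>lborel)
    \<longlongrightarrow> ennreal (unit_ball_vol (DIM('a))) * (\<integral>\<^sup>+x. ennreal (\<bar>v x\<bar> powr p) \<partial>lborel)) (at_right 0)"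
  unfolding tendsto_at_iff_sequentially comp_def
proof (intro allI impI)
  fix X :: "nat \<Rightarrow> real"
  assume "\<forall>i. X i \<in> {0<..} - {0}" and X0: "X \<longlonglongrightarrow> 0"
  then have X: "X i > 0" for i by auto
  have lim: "filterlim X (at_right 0) sequentially"
    using X X0 by (auto simp: filterlim_at less_imp_neq[THEN not_sym])
  have [measurable]: "(\<lambda>x. emeasure lborel (half_slice R p v l x)) \<in> borel_measurable borel" for l
    by (rule half_slice_measurable(2)[OF assms(1) R])
  have "(\<lambda>i. \<integral>\<^sup>+x. ennreal (X i powr p) * emeasure lborel (half_slice R p v (X i) x) \<partial>lborel)
    \<longlonglongrightarrow> (\<integral>\<^sup>+x. ennreal (unit_ball_vol (DIM('a)) * \<bar>v x\<bar> powr p) \<partial>lborel)"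
  proof (rule nn_integral_dominated_convergence
      [where w = "\<lambda>x. ennreal (unit_ball_vol (DIM('a)) * (2 * \<bar>v x\<bar>) powr p)"])
    have "(\<integral>\<^sup>+x. ennreal (unit_ball_vol (DIM('a)) * (2 * \<bar>v x\<bar>) powr p) \<partial>lborel)
      = ennreal (unit_ball_vol (DIM('a)) * 2 powr p) * (\<integral>\<^sup>+x. ennreal (\<bar>v x\<bar> powr p) \<partial>lborel)"
      by (simp add: powr_mult ennreal_mult mult.assoc flip: nn_integral_cmult)
    then show "(\<integral>\<^sup>+x. ennreal (unit_ball_vol (DIM('a)) * (2 * \<bar>v x\<bar>) powr p) \<partial>lborel) < \<infinity>"
      using fin by (simp add: ennreal_mult_less_top)
    show "AE x in lborel. (\<lambda>i. ennreal (X i powr p) * emeasure lborel (half_slice R p v (X i) x))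
        \<longlonglongrightarrow> ennreal (unit_ball_vol (DIM('a)) * \<bar>v x\<bar> powr p)"
      using filterlim_compose[OF half_slice_tendsto[OF assms] lim] by simp
    show "AE x in lborel. ennreal (X i powr p) * emeasure lborel (half_slice R p v (X i) x)
        \<le> ennreal (unit_ball_vol (DIM('a)) * (2 * \<bar>v x\<bar>) powr p)" for i
      using emeasure_half_slice_le[OF assms(1) R X p] by simp
  qed measurable
  then show "(\<lambda>i. \<integral>\<^sup>+x. ennreal (X i powr p) * emeasure lborel (half_slice R p v (X i) x) \<partial>lborel)
    \<longlonglongrightarrow> ennreal (unit_ball_vol (DIM('a))) * (\<integral>\<^sup>+x. ennreal (\<bar>v x\<bar> powr p) \<partial>lborel)"
    by (simp add: ennreal_mult nn_integral_cmult)
qed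

section \<open>Decomposition of the set of pairs and Tonelli's theorem\<close>

text \<open>The inequality is cleared of its denominator. On the diagonal both of its sides are
  \<open>0\<close>, hence the explicit condition \<open>x \<noteq> y\<close>.\<close>

definition quotient_set :: "real \<Rightarrow> ('a::euclidean_space \<Rightarrow> real) \<Rightarrow> real \<Rightarrow> ('a \<times> 'a) set" where
  "quotient_set p v l =
     {(x, y). x \<noteq> y \<and> l * norm (x - y) powr (DIM('a) / p) \<le> \<bar>v x - v y\<bar>}"

text \<open>Each pair is filed under the coordinate where \<open>\<bar>v\<bar>\<close> is larger,
  ties going to the first. Symmetry of the norm and of the absolute value lets the coordinates
  change roles.\<close>

lemma quotient_set_split:
  "quotient_set p v l =
     {(x, y). y \<in> half_slice (\<le>) p v l x} \<union> {(x, y). x \<in> half_slice (<) p v l y}"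
  by (auto simp: quotient_set_def half_slice_def norm_minus_commute abs_minus_commute)

lemma quotient_set_measurable:
  assumes "v \<in> borel_measurable borel"
  shows "quotient_set p v l \<in> sets (lborel \<Otimes>\<^sub>M lborel)"
  unfolding quotient_set_split
  using half_slice_pred_measurable[OF assms] by (intro sets.Un) auto

text \<open>\<open>A\<close> is sliced at fixed \<open>x\<close> and \<open>B\<close> at fixed
  \<open>y\<close>, so that in both integrals the variable is the point with the larger value of
  \<open>\<bar>v\<bar>\<close>.\<close>

lemma emeasure_quotient_set:
  fixes v :: "'a::euclidean_space \<Rightarrow> real"
  assumes [measurable]: "v \<in> borel_measurable borel"
  shows "ennreal (l powr p) * emeasure (lborel \<Otimes>\<^sub>M lborel) (quotient_set p v l) =
     (\<integral>\<^sup>+x. ennreal (l powr p) * emeasure lborel (half_slice (\<le>) p v l x) \<partial>lborel)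
   + (\<integral>\<^sup>+x. ennreal (l powr p) * emeasure lborel (half_slice (<) p v l x) \<partial>lborel)"
proof -
  define A where "A = {(x, y). y \<in> half_slice (\<le>) p v l x}"
  define B where "B = {(x, y). x \<in> half_slice (<) p v l y}"
  have AB: "A \<in> sets (lborel \<Otimes>\<^sub>M lborel)" "B \<in> sets (lborel \<Otimes>\<^sub>M lborel)"
    unfolding A_def B_def using half_slice_pred_measurable[OF assms] by auto
  have "A \<inter> B = {}"
    by (auto simp: A_def B_def half_slice_def)
  then have "emeasure (lborel \<Otimes>\<^sub>M lborel) (quotient_set p v l)
      = emeasure (lborel \<Otimes>\<^sub>M lborel) A + emeasure (lborel \<Otimes>\<^sub>M lborel) B"
    using AB plus_emeasure[of A "lborel \<Otimes>\<^sub>M lborel" B]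
    by (simp add: quotient_set_split A_def B_def)
  also have "emeasure (lborel \<Otimes>\<^sub>M lborel) A
      = (\<integral>\<^sup>+x. emeasure lborel (half_slice (\<le>) p v l x) \<partial>lborel)"
    unfolding lborel.emeasure_pair_measure_alt[OF AB(1)] by (simp add: A_def vimage_def)
  also have "emeasure (lborel \<Otimes>\<^sub>M lborel) B
      = (\<integral>\<^sup>+x. emeasure lborel (half_slice (<) p v l x) \<partial>lborel)"
    unfolding lborel_pair.emeasure_pair_measure_alt2[OF AB(2)] by (simp add: B_def vimage_def)
  finally show ?thesis
    using half_slice_measurable(2)[OF assms, of "(\<le>)"] half_slice_measurable(2)[OF assms, of "(<)"]
    by (simp add: nn_integral_cmult distrib_left)
qed

section \<open>From Borel to Lebesgue measurable functions\<close>

text \<open>The exceptional pairs have a coordinate in a null set \<open>N\<close>, and the product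
  of \<open>N\<close> with the whole space is null in either order.\<close>

lemma AE_pair_both:
  fixes u v :: "'a::euclidean_space \<Rightarrow> 'b"
  assumes "AE x in lborel. u x = v x"
  shows "AE z in lborel. u (fst z) = v (fst z) \<and> u (snd z) = v (snd z)"
proof -
  obtain N where N: "N \<in> null_sets lborel" "{x. u x \<noteq> v x} \<subseteq> N"
    using assms by (auto simp: eventually_ae_filter)
  then have [measurable]: "N \<in> sets borel" by auto
  have 1: "AE x in lborel. x \<notin> N"
    using N(1) by (rule AE_not_in)
  have "AE z in lborel \<Otimes>\<^sub>M lborel. fst z \<notin> N \<and> snd z \<notin> N"
    by (rule lborel_pair.AE_pair_measure, measurable) (use 1 in auto)
  then show ?thesis
    unfolding lborel_prod by eventually_elim (use N(2) in auto)
qed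

text \<open>The two sets differ only by a null set of pairs. Completeness of \<open>lebesgue\<close>
  then makes the set for \<open>u\<close> measurable, even if it is not Borel.\<close>

lemma emeasure_quotient_set_AE_cong:
  fixes u v :: "'a::euclidean_space \<Rightarrow> real"
  assumes v: "v \<in> borel_measurable borel" and "AE x in lborel. u x = v x"
  shows "emeasure lebesgue (quotient_set p u l) = emeasure (lborel \<Otimes>\<^sub>M lborel) (quotient_set p v l)"
proof -
  have "AE z in lebesgue. u (fst z) = v (fst z) \<and> u (snd z) = v (snd z)"
    by (rule AE_completion[OF AE_pair_both[OF assms(2)]])
  then have ae: "AE z in lebesgue. z \<in> quotient_set p v l \<longleftrightarrow> z \<in> quotient_set p u l"
    by eventually_elim (auto simp: quotient_set_def)
  have v_sets: "quotient_set p v l \<in> sets lborel"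
    using quotient_set_measurable[OF v, of p l] unfolding lborel_prod .
  then have "quotient_set p v l \<in> sets lebesgue" by auto
  then have u_sets: "quotient_set p u l \<in> sets lebesgue"
    by (rule completion.in_sets_AE[OF ae]) auto
  have "emeasure lebesgue (quotient_set p u l) = emeasure lebesgue (quotient_set p v l)"
    using ae v_sets u_sets by (intro emeasure_eq_AE) auto
  with v_sets show ?thesis
    unfolding lborel_prod by simp
qed

context
  fixes p :: real and u :: "'a::euclidean_space \<Rightarrow> real"
  assumes p: "p > 0"
    and u: "u \<in> borel_measurable lebesgue"
    and int: "integrable lebesgue (\<lambda>x. \<bar>u x\<bar> powr p)"
begin

text \<open>The slice lemmas ask for Borel functions; a change on a null set provides one without
  altering the integral.\<close>

lemma borel_representative:
  obtains v where "v \<in> borel_measurable borel" "AE x in lborel. u x = v x"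
    "(\<integral>\<^sup>+x. ennreal (\<bar>v x\<bar> powr p) \<partial>lborel) = ennreal (LINT x|lebesgue. \<bar>u x\<bar> powr p)"
proof -
  obtain v where v: "v \<in> borel_measurable borel" "AE x in lborel. u x = v x"
    using completion_ex_borel_measurable_real[OF u] by auto
  have "(\<integral>\<^sup>+x. ennreal (\<bar>v x\<bar> powr p) \<partial>lborel) = (\<integral>\<^sup>+x. ennreal (\<bar>u x\<bar> powr p) \<partial>lborel)"
    using v(2) by (intro nn_integral_cong_AE) auto
  also have "\<dots> = (\<integral>\<^sup>+x. ennreal (\<bar>u x\<bar> powr p) \<partial>lebesgue)"
    by (simp add: nn_integral_completion)
  also have "\<dots> = ennreal (LINT x|lebesgue. \<bar>u x\<bar> powr p)"
    using int by (intro nn_integral_eq_integral) auto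
  finally show ?thesis using v that by blast
qed

text \<open>The factor \<open>2\<close> counts the two halves, while \<open>2 powr p\<close> stems
  from the triangle inequality inside each slice.\<close>

lemma emeasure_quotient_set_le:
  assumes "l > 0"
  shows "ennreal (l powr p) * emeasure lebesgue (quotient_set p u l)
    \<le> ennreal (2 * unit_ball_vol (DIM('a)) * 2 powr p * (LINT x|lebesgue. \<bar>u x\<bar> powr p))"
proof -
  obtain v where v: "v \<in> borel_measurable borel" "AE x in lborel. u x = v x"
    and I: "(\<integral>\<^sup>+x. ennreal (\<bar>v x\<bar> powr p) \<partial>lborel) = ennreal (LINT x|lebesgue. \<bar>u x\<bar> powr p)"
    by (rule borel_representative)
  define C where "C = unit_ball_vol (DIM('a)) * 2 powr p * (LINT x|lebesgue. \<bar>u x\<bar> powr p)"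
  have "C \<ge> 0" by (simp add: C_def)
  have *: "(\<integral>\<^sup>+x. ennreal (l powr p) * emeasure lborel (half_slice R p v l x) \<partial>lborel) \<le> ennreal C"
    if "R = (\<le>) \<or> R = (<)" for R
    using nn_integral_half_slice_le[OF v(1) that assms p] by (simp add: I C_def flip: ennreal_mult)
  have "ennreal (l powr p) * emeasure lebesgue (quotient_set p u l) \<le> ennreal C + ennreal C"
    unfolding emeasure_quotient_set_AE_cong[OF v] emeasure_quotient_set[OF v(1)]
    by (intro add_mono *) auto
  also have "\<dots> = ennreal (2 * C)"
    using \<open>C \<ge> 0\<close> by (simp flip: ennreal_plus)
  finally show ?thesis by (simp add: C_def mult.assoc)
qed

text \<open>Both halves have the same limit. No factor \<open>2 powr p\<close> remains, since the
  limit of each slice involves \<open>\<bar>v x\<bar>\<close> and not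
  \<open>2 * \<bar>v x\<bar>\<close>.\<close>

lemma emeasure_quotient_set_tendsto:
  "((\<lambda>l. ennreal (l powr p) * emeasure lebesgue (quotient_set p u l))
    \<longlongrightarrow> ennreal (2 * unit_ball_vol (DIM('a)) * (LINT x|lebesgue. \<bar>u x\<bar> powr p))) (at_right 0)"
proof -
  obtain v where v: "v \<in> borel_measurable borel" "AE x in lborel. u x = v x"
    and I: "(\<integral>\<^sup>+x. ennreal (\<bar>v x\<bar> powr p) \<partial>lborel) = ennreal (LINT x|lebesgue. \<bar>u x\<bar> powr p)"
    by (rule borel_representative)
  define C where "C = unit_ball_vol (DIM('a)) * (LINT x|lebesgue. \<bar>u x\<bar> powr p)"
  have "C \<ge> 0" by (simp add: C_def)
  have *: "((\<lambda>l. \<integral>\<^sup>+x. ennreal (l powr p) * emeasure lborel (half_slice R p v l x) \<partial>lborel)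
      \<longlongrightarrow> ennreal C) (at_right 0)"
    if "R = (\<le>) \<or> R = (<)" for R
    using nn_integral_half_slice_tendsto[OF v(1) that p] by (simp add: I C_def ennreal_mult)
  have "((\<lambda>l. ennreal (l powr p) * emeasure lebesgue (quotient_set p u l))
      \<longlongrightarrow> ennreal C + ennreal C) (at_right 0)"
    unfolding emeasure_quotient_set_AE_cong[OF v] emeasure_quotient_set[OF v(1)]
    by (intro tendsto_add *) auto
  also have "ennreal C + ennreal C = ennreal (2 * C)"
    using \<open>C \<ge> 0\<close> by (simp flip: ennreal_plus)
  finally show ?thesis by (simp add: C_def mult.assoc)
qed

end

section \<open>Transfer to the weak quasi-norm and the superlevel sets\<close>

lemma superlevel_set_eq:
  fixes u :: "real ^ 'n \<Rightarrow> real"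
  shows "superlevel_set p u l = quotient_set p u l"
  unfolding superlevel_set_def quotient_set_def
  by (rule Collect_cong) (auto simp: pos_le_divide_eq)

text \<open>Positivity of \<open>l\<close> excludes the diagonal, where the quotient is
  \<open>0 / 0 = 0\<close>.\<close>

lemma diff_quotient_level_eq:
  fixes u :: "real ^ 'n \<Rightarrow> real"
  assumes "l > 0"
  shows "{z. \<bar>diff_quotient p u z\<bar> \<ge> l} = quotient_set p u l"
proof -
  have "l \<le> \<bar>u x - u y\<bar> / norm (x - y) powr (real CARD('n) / p)
      \<longleftrightarrow> x \<noteq> y \<and> l * norm (x - y) powr (real CARD('n) / p) \<le> \<bar>u x - u y\<bar>" for x y
    using assms by (cases "x = y") (auto simp: field_simps)
  then show ?thesis
    by (simp add: diff_quotient_def quotient_set_def case_prod_beta')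
qed

lemma ennreal_powr_ennreal: "a \<ge> 0 \<Longrightarrow> ennreal_powr (ennreal a) r = ennreal (a powr r)"
  by (simp add: ennreal_powr_def)

lemma ennreal_powr_mono:
  assumes "a \<le> b" "r \<ge> 0"
  shows "ennreal_powr a r \<le> ennreal_powr b r"
  using assms
  by (auto simp: ennreal_powr_def top_unique less_top intro!: ennreal_leI powr_mono2 enn2real_mono)

lemma Lp_norm_powr:
  assumes "p > 0"
  shows "Lp_norm p u powr p = (LINT x|lebesgue. \<bar>u x\<bar> powr p)"
  using assms by (simp add: Lp_norm_def powr_powr)

context
  fixes p :: real and u :: "real ^ 'n \<Rightarrow> real"
  assumes p: "p \<ge> 1" and u: "u \<in> Lp_space p"
begin

lemma superlevel_set_tendsto:
  "((\<lambda>l. ennreal (l powr p) * emeasure lebesgue (superlevel_set p u l))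
    \<longlongrightarrow> ennreal (2 * unit_ball_vol (real CARD('n)) * Lp_norm p u powr p)) (at_right 0)"
  using emeasure_quotient_set_tendsto[of p u] p u
  by (simp add: Lp_space_def superlevel_set_eq Lp_norm_powr)

text \<open>The root of order \<open>p\<close> turns \<open>2 powr p\<close> into the factor
  \<open>2\<close> and leaves \<open>2 * \<kappa>\<close> under the root.\<close>

lemma weak_Lp_norm_le:
  "weak_Lp_norm p (diff_quotient p u)
    \<le> ennreal (2 * (2 * unit_ball_vol (real CARD('n))) powr (1 / p) * Lp_norm p u)"
  unfolding weak_Lp_norm_def
proof (rule SUP_least)
  define \<kappa> where "\<kappa> = unit_ball_vol (real CARD('n))"
  define I where "I = (LINT x|lebesgue. \<bar>u x\<bar> powr p)"
  fix l :: real assume "l \<in> {0<..}"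
  then have "l > 0" by simp
  then have "ennreal_powr (ennreal (l powr p) * emeasure lebesgue {z. l \<le> \<bar>diff_quotient p u z\<bar>}) (1 / p)
      \<le> ennreal_powr (ennreal (2 * \<kappa> * 2 powr p * I)) (1 / p)"
    using p u emeasure_quotient_set_le[of p u l]
    by (intro ennreal_powr_mono)
       (auto simp: diff_quotient_level_eq Lp_space_def \<kappa>_def I_def)
  also have "\<dots> = ennreal ((2 * \<kappa> * 2 powr p * I) powr (1 / p))"
    by (intro ennreal_powr_ennreal) (auto simp: \<kappa>_def I_def)
  also have "(2 * \<kappa> * 2 powr p * I) powr (1 / p) = 2 * (2 * \<kappa>) powr (1 / p) * Lp_norm p u"
    using p by (simp add: powr_mult powr_powr \<kappa>_def I_def Lp_norm_def)
  finally show "ennreal_powr (ennreal (l powr p) * emeasure lebesgue {z. l \<le> \<bar>diff_quotient p u z\<bar>}) (1 / p)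
      \<le> ennreal (2 * (2 * unit_ball_vol (real CARD('n))) powr (1 / p) * Lp_norm p u)"
    unfolding \<kappa>_def .
qed

text \<open>The supremum bounds the root of \<open>G l\<close> for every \<open>l > 0\<close>, hence
  also its limit at \<open>0\<close>.\<close>

lemma weak_Lp_norm_ge:
  "ennreal ((2 * unit_ball_vol (real CARD('n))) powr (1 / p) * Lp_norm p u)
    \<le> weak_Lp_norm p (diff_quotient p u)"
proof -
  define \<kappa> where "\<kappa> = unit_ball_vol (real CARD('n))"
  define I where "I = (LINT x|lebesgue. \<bar>u x\<bar> powr p)"
  define G where "G l = ennreal (l powr p) * emeasure lebesgue (superlevel_set p u l)" for l
  have nn: "0 \<le> 2 * \<kappa> * I" by (simp add: \<kappa>_def I_def)
  have pos: "\<forall>\<^sub>F l in at_right 0. (0::real) < l"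
    by (rule eventually_at_right_less)
  \<comment> \<open>Finiteness selects the real branch of \<open>ennreal_powr\<close>, so the root
    can be passed to the limit in the reals.\<close>
  have fin: "G l < top" if "l > 0" for l
    using emeasure_quotient_set_le[of p u l] that p u
    by (auto simp: G_def superlevel_set_eq Lp_space_def intro: le_less_trans)
  have "(G \<longlongrightarrow> ennreal (2 * \<kappa> * I)) (at_right 0)"
    using superlevel_set_tendsto p unfolding G_def \<kappa>_def I_def by (simp add: Lp_norm_powr)
  \<comment> \<open>The limit \<open>2 * \<kappa> * I\<close> may be \<open>0\<close>; the root is
    continuous there too because \<open>1 / p\<close> is positive.\<close>
  then have "((\<lambda>l. enn2real (G l)) \<longlongrightarrow> 2 * \<kappa> * I) (at_right 0)"
    using tendsto_enn2real nn by blast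
  then have "((\<lambda>l. ennreal (enn2real (G l) powr (1 / p)))
      \<longlongrightarrow> ennreal ((2 * \<kappa> * I) powr (1 / p))) (at_right 0)"
    using p by (intro tendsto_ennrealI tendsto_powr') auto
  moreover have "\<forall>\<^sub>F l in at_right 0.
      ennreal (enn2real (G l) powr (1 / p)) \<le> weak_Lp_norm p (diff_quotient p u)"
    using pos
  proof eventually_elim
    case (elim l)
    have "ennreal (enn2real (G l) powr (1 / p)) = ennreal_powr (G l) (1 / p)"
      using fin[OF elim] by (simp add: ennreal_powr_def)
    also have "\<dots> \<le> weak_Lp_norm p (diff_quotient p u)"
      unfolding weak_Lp_norm_def G_def
      by (rule SUP_upper2[of l]) (use elim in \<open>auto simp: diff_quotient_level_eq superlevel_set_eq\<close>)
    finally show ?case .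
  qed
  ultimately have "ennreal ((2 * \<kappa> * I) powr (1 / p)) \<le> weak_Lp_norm p (diff_quotient p u)"
    by (intro tendsto_upperbound[where F = "at_right (0::real)"]) auto
  also have "(2 * \<kappa> * I) powr (1 / p) = (2 * \<kappa>) powr (1 / p) * Lp_norm p u"
    by (simp add: powr_mult \<kappa>_def I_def Lp_norm_def)
  finally show ?thesis unfolding \<kappa>_def .
qed

end

theorem theorem1p1:
  shows "(\<exists>c1>0. \<exists>c2>0. \<forall>p\<ge>1. \<forall>u \<in> (Lp_space p :: (real ^ 'n::finite \<Rightarrow> real) set).
            ennreal (c1 powr (1 / p) * Lp_norm p u) \<le> weak_Lp_norm p (diff_quotient p u) \<and>
            weak_Lp_norm p (diff_quotient p u) \<le> ennreal (2 * c2 powr (1 / p) * Lp_norm p u))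
       \<and> (\<forall>p\<ge>1. \<forall>u \<in> (Lp_space p :: (real ^ 'n \<Rightarrow> real) set).
            ((\<lambda>l. ennreal (l powr p) * emeasure lebesgue (superlevel_set p u l))
              \<longlongrightarrow> ennreal (2 * unit_ball_vol (real CARD('n)) * Lp_norm p u powr p)) (at_right 0))"
proof -
  have "2 * unit_ball_vol (real CARD('n)) > 0" by simp
  then show ?thesis
    \<comment> \<open>The same witness, independent of \<open>p\<close> and \<open>u\<close>, serves
      for both \<open>c1\<close> and \<open>c2\<close>.\<close>
    by (intro conjI exI[of _ "2 * unit_ball_vol (real CARD('n))"] allI impI ballI
        weak_Lp_norm_ge weak_Lp_norm_le superlevel_set_tendsto)
qed

end
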